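(* Let $f:\mathbb{R}^n\to\mathbb{R}$ be twice differentiable with $\|\nabla^2 f(y)-\nabla^2 f(z)\|\le L_H\|y-z\|$ for all $y,z\in\mathbb{R}^n$. Let $x\in\mathbb{R}^n$, $g=\nabla f(x)\neq 0$, $H=\nabla^2 f(x)$, $M>0$, and let $s^\star$ be a global minimizer over $\mathbb{R}^n$ of $m(s)=\langle g,s\rangle+\tfrac12\langle Hs,s\rangle+\tfrac{M}{6}\|s\|^3$, with $r^\star=\|s^\star\|$. Then the point $x^+=x+s^\star$ satisfies $$\|\nabla f(x^+)\|\le\frac{L_H+M}{2}\,(r^\star)^2 .$$
   Context: Norms are Euclidean for vectors and spectral for matrices. *)

theory Defs
  imports "HOL-Analysis.Analysis"
begin

definition gradient :: "('a::real_inner \<Rightarrow> real) \<Rightarrow> 'a \<Rightarrow> 'a" where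
  "gradient f x = (THE D. GDERIV f x :> D)"

(* Its (i, j) entry is the j-th partial
   derivative of the i-th component of the gradient. *)
definition hessian :: "(real ^ 'n \<Rightarrow> real) \<Rightarrow> real ^ 'n \<Rightarrow> real ^ 'n ^ 'n" where
  "hessian f x = jacobian (gradient f) (at x)"

(* Twice differentiability in the Frechet sense; continuity of the second derivative
   is not part of the notion. *)
definition twice_differentiable :: "(real ^ 'n \<Rightarrow> real) \<Rightarrow> bool" where
  "twice_differentiable f \<longleftrightarrow>
     (\<forall>x. f differentiable (at x)) \<and> (\<forall>x. gradient f differentiable (at x))"

(* Vectors carry the Euclidean norm, so this operator norm is the spectral norm. The
   library's norm on real ^ 'n ^ 'm is the Frobenius norm and is not used for matrices. *)
definition spectral_norm :: "real ^ 'n ^ 'm \<Rightarrow> real" where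
  "spectral_norm A = onorm (\<lambda>v. A *v v)"

definition cubic_model :: "real ^ 'n \<Rightarrow> real ^ 'n ^ 'n \<Rightarrow> real \<Rightarrow> real ^ 'n \<Rightarrow> real" where
  "cubic_model g H M s = g \<bullet> s + 1 / 2 * ((H *v s) \<bullet> s) + M / 6 * norm s ^ 3"

end

theory Submission
  imports Defs
begin

text \<open>
  Stationarity of the cubic model at its minimizer \<open>s\<close> reads
  \<open>g + H s = - (M / 2) \<parallel>s\<parallel> s\<close>, a vector of norm \<open>M / 2 \<parallel>s\<parallel>\<^sup>2\<close>; this uses that \<open>H\<close> is symmetric,
  which holds because it is the derivative of a gradient. The Lipschitz bound on the Hessian makes
  \<open>g + H s\<close> approximate the gradient at \<open>x + s\<close> up to \<open>L_H / 2 \<parallel>s\<parallel>\<^sup>2\<close>. The triangle inequality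
  adds up the two contributions.
\<close>

text \<open>In finite dimension the derivative is represented by the vector whose coordinates are
  its values on the basis. Since \<open>gradient\<close> is a definite description, uniqueness of
  that vector must be shown as well.\<close>

lemma GDERIV_gradient:
  fixes f :: "'a::euclidean_space \<Rightarrow> real"
  assumes "f differentiable (at x)"
  shows "GDERIV f x :> gradient f x"
proof -
  obtain f' where f': "(f has_derivative f') (at x)"
    using assms by (auto simp: differentiable_def)
  define D where "D = (\<Sum>b\<in>Basis. f' b *\<^sub>R b)"
  have "f' h = h \<bullet> D" for h
  proof -
    have "f' h = f' (\<Sum>b\<in>Basis. (h \<bullet> b) *\<^sub>R b)"
      by (simp add: euclidean_representation)
    also have "\<dots> = (\<Sum>b\<in>Basis. (h \<bullet> b) * f' b)"
      using has_derivative_linear[OF f'] by (simp add: linear_sum linear_scale)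
    finally show ?thesis
      by (simp add: D_def inner_sum_right mult.commute)
  qed
  then have D: "GDERIV f x :> D"
    using f' unfolding gderiv_def by (metis (no_types, lifting) ext)
  have "E = D" if "GDERIV f x :> E" for E
  proof -
    have "(\<lambda>h. h \<bullet> E) = (\<lambda>h. h \<bullet> D)"
      using that D unfolding gderiv_def by (rule has_derivative_unique)
    \<comment> \<open>Both functionals are evaluated at \<open>E - D\<close>.\<close>
    then have "(E - D) \<bullet> E = (E - D) \<bullet> D"
      by (rule fun_cong)
    then have "(E - D) \<bullet> (E - D) = 0"
      by (simp add: inner_diff_right)
    then show ?thesis
      by simp
  qed
  with D show ?thesis
    unfolding gradient_def by (rule theI)
qed

text \<open>
  The second difference of \<open>f\<close> is symmetric in \<open>u\<close> and \<open>v\<close>, and by the mean value theorem it is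
  close to \<open>A u \<bullet> v\<close> for small \<open>u\<close> and \<open>v\<close>.
\<close>

lemma derivative_of_gradient_symmetric:
  fixes f :: "'a::real_inner \<Rightarrow> real"
  assumes F: "\<And>y. GDERIV f y :> F y"
    and A: "(F has_derivative A) (at x)"
  shows "A u \<bullet> v = A v \<bullet> u"
proof (rule ccontr)
  assume neq: "A u \<bullet> v \<noteq> A v \<bullet> u"
  define c where "c = \<bar>A u \<bullet> v - A v \<bullet> u\<bar>"
  define K where "K = norm u + norm v"
  \<comment> \<open>The estimates below lead to \<open>c \<le> 4 * e * K\<^sup>2\<close>, which this
    choice contradicts. The summand 1 keeps the denominator positive without a case split on
    \<open>K = 0\<close>.\<close>
  define e where "e = c / (8 * K\<^sup>2 + 1)"
  have "c > 0"
    using neq by (simp add: c_def)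
  have "K \<ge> 0"
    by (simp add: K_def)
  have den: "8 * K\<^sup>2 + 1 > 0"
    by (simp add: add_nonneg_pos)
  then have "e > 0"
    using \<open>c > 0\<close> by (simp add: e_def)
  interpret A: linear A
    using A by (rule has_derivative_linear)
  obtain d where "d > 0"
    and d: "\<And>y. norm (y - x) < d \<Longrightarrow> norm (F y - F x - A (y - x)) \<le> e * norm (y - x)"
    using A \<open>e > 0\<close> unfolding has_derivative_within_alt by (auto simp: Ball_def)
  define R where "R w = F (x + w) - F x - A w" for w
  have R: "norm (R w) \<le> e * norm w" if "norm w < d" for w
    using d[of "x + w"] that by (simp add: R_def)
  define S where "S a b = f (x + a + b) - f (x + a) - f (x + b) + f x" for a b
  have S_commute: "S a b = S b a" for a b
    by (simp add: S_def add.commute add.left_commute)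
  have S: "\<bar>S a b - A a \<bullet> b\<bar> \<le> 2 * e * (norm a + norm b)\<^sup>2" if small: "norm a + norm b < d" for a b
  proof -
    \<comment> \<open>The increment \<open>\<phi> 1 - \<phi> 0\<close> is the second difference
      \<open>S a b\<close>, so a single use of the mean value theorem reduces it to values of
      \<open>F\<close>.\<close>
    define \<phi> where "\<phi> \<tau> = f (x + a + \<tau> *\<^sub>R b) - f (x + \<tau> *\<^sub>R b)" for \<tau>
    have line: "((\<lambda>\<tau>. f (y + \<tau> *\<^sub>R b)) has_real_derivative b \<bullet> F (y + \<tau> *\<^sub>R b)) (at \<tau>)" for y \<tau>
    proof -
      have "((\<lambda>\<tau>. f (y + \<tau> *\<^sub>R b)) has_derivative (\<lambda>h. (h *\<^sub>R b) \<bullet> F (y + \<tau> *\<^sub>R b))) (at \<tau>)"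
        using F[of "y + \<tau> *\<^sub>R b", unfolded gderiv_def]
        by (rule has_derivative_compose[rotated]) (auto intro!: derivative_eq_intros)
      then show ?thesis
        by (simp add: has_field_derivative_def mult_commute_abs)
    qed
    have deriv: "(\<phi> has_real_derivative b \<bullet> F (x + a + \<tau> *\<^sub>R b) - b \<bullet> F (x + \<tau> *\<^sub>R b)) (at \<tau>)" for \<tau>
      unfolding \<phi>_def by (intro DERIV_diff line)
    obtain \<xi> where \<xi>: "0 < \<xi>" "\<xi> < 1"
      and "\<phi> 1 - \<phi> 0 = (1 - 0) * (b \<bullet> F (x + a + \<xi> *\<^sub>R b) - b \<bullet> F (x + \<xi> *\<^sub>R b))"
      using MVT2[OF zero_less_one deriv] by blast
    then have "S a b = b \<bullet> F (x + (a + \<xi> *\<^sub>R b)) - b \<bullet> F (x + \<xi> *\<^sub>R b)"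
      by (simp add: \<phi>_def S_def add.assoc)
    \<comment> \<open>Expanding \<open>F\<close> around \<open>x\<close> at both points, the terms
      \<open>F x\<close> and \<open>A (\<xi> *\<^sub>R b)\<close> cancel; apart from
      \<open>A a\<close> only the remainders survive.\<close>
    then have eq: "S a b - A a \<bullet> b = b \<bullet> (R (a + \<xi> *\<^sub>R b) - R (\<xi> *\<^sub>R b))"
      by (simp add: R_def A.add A.scale inner_diff_right inner_add_right inner_commute)
    have \<xi>b: "norm (\<xi> *\<^sub>R b) \<le> norm b"
      using \<xi> by (simp add: mult_left_le_one_le)
    have a\<xi>b: "norm (a + \<xi> *\<^sub>R b) \<le> norm a + norm b"
      using norm_triangle_ineq[of a "\<xi> *\<^sub>R b"] \<xi>b by linarith
    have "norm (R (a + \<xi> *\<^sub>R b)) \<le> e * norm (a + \<xi> *\<^sub>R b)"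
      using a\<xi>b small by (intro R) linarith
    also have "\<dots> \<le> e * (norm a + norm b)"
      using a\<xi>b \<open>e > 0\<close> by (intro mult_left_mono) auto
    finally have R1: "norm (R (a + \<xi> *\<^sub>R b)) \<le> e * (norm a + norm b)" .
    have "norm (\<xi> *\<^sub>R b) \<le> norm a + norm b"
      using \<xi>b norm_ge_zero[of a] by linarith
    moreover have "norm (R (\<xi> *\<^sub>R b)) \<le> e * norm (\<xi> *\<^sub>R b)"
      using \<xi>b small norm_ge_zero[of a] by (intro R) linarith
    ultimately have R2: "norm (R (\<xi> *\<^sub>R b)) \<le> e * (norm a + norm b)"
      using \<open>e > 0\<close> by (meson less_imp_le mult_left_mono order_trans)
    have "\<bar>S a b - A a \<bullet> b\<bar> \<le> norm b * norm (R (a + \<xi> *\<^sub>R b) - R (\<xi> *\<^sub>R b))"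
      unfolding eq by (rule Cauchy_Schwarz_ineq2)
    also have "\<dots> \<le> (norm a + norm b) * (2 * e * (norm a + norm b))"
      using R1 R2 norm_triangle_ineq4[of "R (a + \<xi> *\<^sub>R b)" "R (\<xi> *\<^sub>R b)"]
      by (intro mult_mono) auto
    finally show ?thesis
      by (simp add: power2_eq_square mult_ac)
  qed
  \<comment> \<open>Shrinking \<open>u\<close> and \<open>v\<close> by \<open>t\<close> brings them
    into the range where \<open>S\<close> applies. Both sides of the resulting inequality scale with
    the square of \<open>t\<close>, which then cancels.\<close>
  define t where "t = d / (K + 1)"
  have "t > 0"
    using \<open>d > 0\<close> \<open>K \<ge> 0\<close> by (simp add: t_def)
  have norms: "norm (t *\<^sub>R u) + norm (t *\<^sub>R v) = t * K"
    using \<open>t > 0\<close> by (simp add: K_def distrib_left)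
  have "t * K < d"
    using \<open>d > 0\<close> \<open>K \<ge> 0\<close> by (simp add: t_def field_simps)
  then have "\<bar>S (t *\<^sub>R u) (t *\<^sub>R v) - A (t *\<^sub>R u) \<bullet> (t *\<^sub>R v)\<bar> \<le> 2 * e * (t * K)\<^sup>2"
    and "\<bar>S (t *\<^sub>R v) (t *\<^sub>R u) - A (t *\<^sub>R v) \<bullet> (t *\<^sub>R u)\<bar> \<le> 2 * e * (t * K)\<^sup>2"
    using S[of "t *\<^sub>R u" "t *\<^sub>R v"] S[of "t *\<^sub>R v" "t *\<^sub>R u"] norms by (simp_all add: add.commute)
  then have "\<bar>A (t *\<^sub>R u) \<bullet> (t *\<^sub>R v) - A (t *\<^sub>R v) \<bullet> (t *\<^sub>R u)\<bar> \<le> 4 * e * (t * K)\<^sup>2"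
    using S_commute[of "t *\<^sub>R u" "t *\<^sub>R v"] by linarith
  moreover have "A (t *\<^sub>R u) \<bullet> (t *\<^sub>R v) - A (t *\<^sub>R v) \<bullet> (t *\<^sub>R u) = t\<^sup>2 * (A u \<bullet> v - A v \<bullet> u)"
    by (simp add: A.scale power2_eq_square algebra_simps)
  ultimately have "t\<^sup>2 * c \<le> t\<^sup>2 * (4 * e * K\<^sup>2)"
    by (simp add: c_def abs_mult power_mult_distrib mult_ac)
  then have "c \<le> 4 * e * K\<^sup>2"
    using \<open>t > 0\<close> by simp
  also have "\<dots> < c"
    using \<open>c > 0\<close> den by (simp add: e_def field_simps add_pos_nonneg)
  finally show False
    by simp
qed

text \<open>Away from 0 this is the chain rule. The norm itself is not differentiable at 0, so there
  the difference quotient is computed directly: it equals \<open>(norm h)\<^sup>2\<close>, which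
  tends to 0.\<close>

lemma has_derivative_norm_cubed:
  fixes x :: "'a::real_inner"
  shows "((\<lambda>y. norm y ^ 3) has_derivative (\<lambda>h. 3 * norm x * (x \<bullet> h))) (at x)"
proof (cases "x = 0")
  case True
  have "((\<lambda>h::'a. norm h ^ 3 / norm h) \<longlongrightarrow> 0) (at 0)"
  proof (rule Lim_transform_eventually)
    show "((\<lambda>h::'a. (norm h)\<^sup>2) \<longlongrightarrow> 0) (at 0)"
      by (auto intro!: tendsto_eq_intros)
    show "\<forall>\<^sub>F h::'a in at 0. (norm h)\<^sup>2 = norm h ^ 3 / norm h"
      by (auto simp: eventually_at_filter power2_eq_square power3_eq_cube)
  qed
  then show ?thesis
    by (simp add: True has_derivative_at)
next
  case False
  then show ?thesis
    by (auto intro!: derivative_eq_intros has_derivative_norm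
        simp: sgn_div_norm power2_eq_square inner_commute fun_eq_iff)
qed

text \<open>The derivative vanishes at a minimizer. Symmetry merges the two terms from
  differentiating the quadratic form into \<open>(H *v s) \<bullet> h\<close>, so that
  \<open>G\<close> is the gradient of the model at \<open>s\<close>.\<close>

lemma cubic_model_stationary:
  assumes sym: "\<And>u v. (H *v u) \<bullet> v = (H *v v) \<bullet> u"
    and min: "\<And>t. cubic_model g H M s \<le> cubic_model g H M t"
  shows "g + H *v s = - (M / 2 * norm s) *\<^sub>R s"
proof -
  define G where "G = g + H *v s + (M / 2 * norm s) *\<^sub>R s"
  have H: "((\<lambda>y. H *v y) has_derivative (\<lambda>h. H *v h)) (at s)"
    by (intro linear_imp_has_derivative matrix_vector_mul_linear)
  have "(cubic_model g H M has_derivative (\<lambda>h. G \<bullet> h)) (at s)"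
    unfolding cubic_model_def
    by (rule derivative_eq_intros H has_derivative_norm_cubed refl)+
      (simp add: G_def fun_eq_iff sym[of _ s] inner_add_left algebra_simps)
  then have "(\<lambda>h. G \<bullet> h) = (\<lambda>h. 0)"
    using min by (intro differential_zero_maxmin[of s UNIV]) auto
  then have "G \<bullet> G = 0"
    by (rule fun_cong)
  then have "G = 0"
    by simp
  then show ?thesis
    by (simp add: G_def eq_neg_iff_add_eq_0)
qed

text \<open>A mean value inequality along the segment from \<open>x\<close> to \<open>x + s\<close>
  replaces integration of the Jacobian: the speed of the remainder at time \<open>t\<close> is at
  most \<open>L * t * norm s ^ 2\<close>, and the antiderivative of \<open>t\<close> yields the
  factor 1/2.\<close>

lemma lipschitz_jacobian_remainder_bound:
  fixes F :: "real ^ 'n \<Rightarrow> real ^ 'm"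
  assumes J: "\<And>y. (F has_derivative (\<lambda>h. J y *v h)) (at y)"
    and lip: "\<And>y. spectral_norm (J y - J x) \<le> L * norm (y - x)"
  shows "norm (F (x + s) - F x - J x *v s) \<le> L / 2 * norm s ^ 2"
proof -
  \<comment> \<open>Subtracting the linear part makes the derivative of \<open>\<psi>\<close> a
    Jacobian difference applied to \<open>s\<close>.\<close>
  define \<psi> where "\<psi> t = F (x + t *\<^sub>R s) - t *\<^sub>R (J x *v s)" for t
  have "((\<lambda>t. F (x + t *\<^sub>R s)) has_vector_derivative J (x + t *\<^sub>R s) *v s) (at t)" for t
  proof -
    have "((\<lambda>t. F (x + t *\<^sub>R s)) has_derivative (\<lambda>h. J (x + t *\<^sub>R s) *v (h *\<^sub>R s))) (at t)"
      by (rule has_derivative_compose[OF _ J]) (auto intro!: derivative_eq_intros)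
    then show ?thesis
      by (simp add: has_vector_derivative_def matrix_vector_mult_scaleR)
  qed
  then have \<psi>: "(\<psi> has_vector_derivative (J (x + t *\<^sub>R s) - J x) *v s) (at t)" for t
    unfolding \<psi>_def
    by (auto intro!: derivative_eq_intros simp: matrix_vector_mult_diff_rdistrib)
  \<comment> \<open>The right-hand side is the increment over [0, 1] of the comparison function
    \<open>L / 2 * norm s ^ 2 * t\<^sup>2\<close>.\<close>
  have "norm (\<psi> 1 - \<psi> 0) \<le> L / 2 * norm s ^ 2 * 1\<^sup>2 - L / 2 * norm s ^ 2 * 0\<^sup>2"
  proof (rule differentiable_bound_general)
    show "continuous_on {0..1} \<psi>"
      using \<psi> by (meson continuous_at_imp_continuous_on has_vector_derivative_continuous)
    show "((\<lambda>t. L / 2 * norm s ^ 2 * t\<^sup>2) has_vector_derivative L * t * norm s ^ 2) (at t)" for t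
      by (auto intro!: derivative_eq_intros simp flip: has_real_derivative_iff_has_vector_derivative)
    fix t :: real
    assume "0 < t"
    have "norm ((J (x + t *\<^sub>R s) - J x) *v s) \<le> spectral_norm (J (x + t *\<^sub>R s) - J x) * norm s"
      unfolding spectral_norm_def by (intro onorm matrix_vector_mul_bounded_linear)
    also have "\<dots> \<le> L * norm (x + t *\<^sub>R s - x) * norm s"
      by (intro mult_right_mono lip) simp
    finally show "norm ((J (x + t *\<^sub>R s) - J x) *v s) \<le> L * t * norm s ^ 2"
      using \<open>0 < t\<close> by (simp add: power2_eq_square mult_ac)
  qed (auto intro!: continuous_intros \<psi>)
  then show ?thesis
    by (simp add: \<psi>_def algebra_simps)
qed

theorem lemma3p9:
  fixes f :: "real ^ 'n \<Rightarrow> real"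
    and x g s :: "real ^ 'n"
    and H :: "real ^ 'n ^ 'n"
    and L_H M r :: real
  assumes "twice_differentiable f"
    and "\<And>y z. spectral_norm (hessian f y - hessian f z) \<le> L_H * norm (y - z)"
    and "g = gradient f x"
    and "g \<noteq> 0"
    and "H = hessian f x"
    and "M > 0"
    and "\<And>t. cubic_model g H M s \<le> cubic_model g H M t"
    and "r = norm s"
  shows "norm (gradient f (x + s)) \<le> (L_H + M) / 2 * r ^ 2"
proof -
  have grad: "GDERIV f y :> gradient f y" for y
    using assms(1) by (simp add: twice_differentiable_def GDERIV_gradient)
  have hess: "(gradient f has_derivative (\<lambda>h. hessian f y *v h)) (at y)" for y
    using assms(1) unfolding hessian_def by (simp add: twice_differentiable_def flip: jacobian_works)
  have "(H *v u) \<bullet> v = (H *v v) \<bullet> u" for u v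
    using derivative_of_gradient_symmetric[OF grad hess] by (simp add: assms(5))
  \<comment> \<open>Norms are taken in the stationarity equation; \<open>M > 0\<close> removes the
    absolute value of the scalar factor.\<close>
  then have "norm (g + H *v s) = M / 2 * r\<^sup>2"
    using cubic_model_stationary[OF _ assms(7)] assms(6,8)
    by (simp add: power2_eq_square)
  moreover have "norm (gradient f (x + s) - (g + H *v s)) \<le> L_H / 2 * r\<^sup>2"
    using lipschitz_jacobian_remainder_bound[OF hess assms(2), of x s] assms(3,5,8)
    by (simp add: diff_diff_eq)
  ultimately have "norm (gradient f (x + s)) \<le> L_H / 2 * r\<^sup>2 + M / 2 * r\<^sup>2"
    using norm_triangle_sub[of "gradient f (x + s)" "g + H *v s"] by linarith
  then show ?thesis
    by (simp add: add_divide_distrib distrib_right)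
qed

end
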